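(* Let $H$ be a complex Hilbert space, let $\mathcal{F}$ be a complete totally ordered family of partial isometries in $B(H)$, and let $$\mathcal{A}_{\mathcal{F}}=\{T\in B(H)\colon (I-Q_E)TP_E=0 \text{ for all } E\in\mathcal{F}\}.$$ If $\mathcal{A}_{\mathcal{F}}$ is an algebra, then (i) the family $\mathcal{F}$ consists entirely of power partial isometries, or (ii) all partial isometries in $\mathcal{F}$ are power partial isometries except for the supremum $\vee\mathcal{F}$, and $\operatorname{ran}(\vee\mathcal{F})=H$.
   Context: $B(H)$ is the set of bounded linear operators on $H$ and $I$ is the identity operator. A partial isometry is $V\in B(H)$ with $\|Vx\|=\|x\|$ for all $x\in\ker(V)^\perp$; its initial space is $\ker(V)^\perp$ and its final space is $\operatorname{ran}(V)$. $P_V=V^*V$ and $Q_V=VV^*$ are the orthogonal projections onto the initial and final spaces. Partial isometries are ordered by the Halmos--McLaughlin ordering: $E\le F$ if $F(x)=E(x)$ for all $x$ in the initial space of $E$ (so that the initial space of $E$ is contained in that of $F$). A family of partial isometries is complete if it contains $0$ and, for every nonempty subset of it, the supremum and infimum (in the poset of all partial isometries on $H$) exist and lie in the family. "Algebra" means subalgebra of $B(H)$. A power partial isometry is $V\in B(H)$ such that $V^n$ is a partial isometry for every positive integer $n$. *)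

theory Defs
  imports "HOL-Analysis.Analysis"
begin

text \<open>Complex Hilbert spaces, with the inner product linear in the first argument. The axiom
  \<open>cinner_self\<close> says both that the inner product is positive definite and that it induces the
  norm.\<close>

class complex_inner = real_normed_vector +
  fixes scaleC :: "complex \<Rightarrow> 'a \<Rightarrow> 'a"  (infixr \<open>*\<^sub>C\<close> 75)
    and cinner :: "'a \<Rightarrow> 'a \<Rightarrow> complex"
  assumes scaleC_add_right: "c *\<^sub>C (x + y) = c *\<^sub>C x + c *\<^sub>C y"
    and scaleC_add_left: "(c + d) *\<^sub>C x = c *\<^sub>C x + d *\<^sub>C x"
    and scaleC_scaleC: "c *\<^sub>C (d *\<^sub>C x) = (c * d) *\<^sub>C x"
    and scaleC_one: "1 *\<^sub>C x = x"
    and scaleR_scaleC: "scaleR r x = complex_of_real r *\<^sub>C x"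
    and cinner_commute: "cinner x y = cnj (cinner y x)"
    and cinner_add_left: "cinner (x + y) z = cinner x z + cinner y z"
    and cinner_scaleC_left: "cinner (c *\<^sub>C x) y = c * cinner x y"
    and cinner_self: "cinner x x = complex_of_real ((norm x)\<^sup>2)"

class chilbert_space = complex_inner + complete_space

instantiation complex :: chilbert_space
begin

definition scaleC_complex :: "complex \<Rightarrow> complex \<Rightarrow> complex" where
  "scaleC_complex c x = c * x"

definition cinner_complex :: "complex \<Rightarrow> complex \<Rightarrow> complex" where
  "cinner_complex x y = x * cnj y"

instance
  by standard
    (simp_all add: scaleC_complex_def cinner_complex_def algebra_simps scaleR_conv_of_real
      complex_norm_square[symmetric])

end

definition bounded_ops :: "('a::chilbert_space \<Rightarrow> 'a) set" where
  "bounded_ops = {T. bounded_linear T \<and> (\<forall>c x. T (c *\<^sub>C x) = c *\<^sub>C T x)}"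

definition orth_compl :: "'a::chilbert_space set \<Rightarrow> 'a set" where
  "orth_compl S = {x. \<forall>y\<in>S. cinner x y = 0}"

definition initial_space :: "('a::chilbert_space \<Rightarrow> 'a) \<Rightarrow> 'a set" where
  "initial_space V = orth_compl {x. V x = 0}"

definition partial_isometry :: "('a::chilbert_space \<Rightarrow> 'a) \<Rightarrow> bool" where
  "partial_isometry V \<longleftrightarrow>
     V \<in> bounded_ops \<and> (\<forall>x\<in>initial_space V. norm (V x) = norm x)"

definition power_partial_isometry :: "('a::chilbert_space \<Rightarrow> 'a) \<Rightarrow> bool" where
  "power_partial_isometry V \<longleftrightarrow>
     V \<in> bounded_ops \<and> (\<forall>n\<ge>1. partial_isometry (V ^^ n))"

definition adjoint_op :: "('a::chilbert_space \<Rightarrow> 'a) \<Rightarrow> ('a \<Rightarrow> 'a)" where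
  "adjoint_op V = (THE W. W \<in> bounded_ops \<and> (\<forall>x y. cinner (V x) y = cinner x (W y)))"

definition initial_proj :: "('a::chilbert_space \<Rightarrow> 'a) \<Rightarrow> ('a \<Rightarrow> 'a)" where
  "initial_proj V = adjoint_op V \<circ> V"

definition final_proj :: "('a::chilbert_space \<Rightarrow> 'a) \<Rightarrow> ('a \<Rightarrow> 'a)" where
  "final_proj V = V \<circ> adjoint_op V"

text \<open>The Halmos--McLaughlin ordering. Suprema and infima below are taken in the poset of all
  partial isometries; on partial isometries the relation is antisymmetric, so they are unique when
  they exist.\<close>

definition hm_le :: "('a::chilbert_space \<Rightarrow> 'a) \<Rightarrow> ('a \<Rightarrow> 'a) \<Rightarrow> bool"  (infix \<open>\<preceq>\<close> 50) where
  "E \<preceq> F \<longleftrightarrow> (\<forall>x\<in>initial_space E. F x = E x)"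

definition is_pi_sup :: "('a::chilbert_space \<Rightarrow> 'a) set \<Rightarrow> ('a \<Rightarrow> 'a) \<Rightarrow> bool" where
  "is_pi_sup S U \<longleftrightarrow> partial_isometry U \<and> (\<forall>E\<in>S. E \<preceq> U) \<and>
     (\<forall>W. partial_isometry W \<and> (\<forall>E\<in>S. E \<preceq> W) \<longrightarrow> U \<preceq> W)"

definition is_pi_inf :: "('a::chilbert_space \<Rightarrow> 'a) set \<Rightarrow> ('a \<Rightarrow> 'a) \<Rightarrow> bool" where
  "is_pi_inf S L \<longleftrightarrow> partial_isometry L \<and> (\<forall>E\<in>S. L \<preceq> E) \<and>
     (\<forall>W. partial_isometry W \<and> (\<forall>E\<in>S. W \<preceq> E) \<longrightarrow> W \<preceq> L)"

definition pi_Sup :: "('a::chilbert_space \<Rightarrow> 'a) set \<Rightarrow> ('a \<Rightarrow> 'a)" where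
  "pi_Sup S = (THE U. is_pi_sup S U)"

definition complete_family :: "('a::chilbert_space \<Rightarrow> 'a) set \<Rightarrow> bool" where
  "complete_family \<F> \<longleftrightarrow> (\<forall>E\<in>\<F>. partial_isometry E) \<and> (\<lambda>x. 0) \<in> \<F> \<and>
     (\<forall>S. S \<subseteq> \<F> \<and> S \<noteq> {} \<longrightarrow> (\<exists>U\<in>\<F>. is_pi_sup S U) \<and> (\<exists>L\<in>\<F>. is_pi_inf S L))"

definition totally_ordered_family :: "('a::chilbert_space \<Rightarrow> 'a) set \<Rightarrow> bool" where
  "totally_ordered_family \<F> \<longleftrightarrow> (\<forall>E\<in>\<F>. \<forall>F\<in>\<F>. E \<preceq> F \<or> F \<preceq> E)"

definition A_of :: "('a::chilbert_space \<Rightarrow> 'a) set \<Rightarrow> ('a \<Rightarrow> 'a) set" where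
  "A_of \<F> = {T \<in> bounded_ops.
     \<forall>E\<in>\<F>. (\<lambda>x. x - final_proj E x) \<circ> T \<circ> initial_proj E = (\<lambda>x. 0)}"

text \<open>Subalgebras of the bounded operators; they need not contain the identity.\<close>

definition subalgebra_ops :: "('a::chilbert_space \<Rightarrow> 'a) set \<Rightarrow> bool" where
  "subalgebra_ops A \<longleftrightarrow> A \<subseteq> bounded_ops \<and> (\<lambda>x. 0) \<in> A \<and>
     (\<forall>S\<in>A. \<forall>T\<in>A. (\<lambda>x. S x + T x) \<in> A) \<and>
     (\<forall>c. \<forall>T\<in>A. (\<lambda>x. c *\<^sub>C T x) \<in> A) \<and>
     (\<forall>S\<in>A. \<forall>T\<in>A. S \<circ> T \<in> A)"

end

theory Submission
  imports Defs
begin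

text \<open>Let \<open>U\<close> be the supremum of \<open>\<F>\<close>. Completeness puts it into \<open>\<F>\<close>, and every other member is
  the restriction of \<open>U\<close> to a smaller initial space, extended by zero. Membership of \<open>T\<close> in
  \<open>A_of \<F>\<close> means that \<open>T\<close> maps the initial space of each \<open>E\<close> in \<open>\<F>\<close> into the range of \<open>E\<close>
  (\<open>A_of_iff\<close>). In particular \<open>U\<close> itself belongs to \<open>A_of \<F>\<close>, and it maps each initial space
  onto the corresponding range. So if \<open>A_of \<F>\<close> is closed under composition, all its operators
  leave the range of every member invariant (\<open>A_of_preserves_range\<close>).

  This is now tested on the operators \<open>rank_one f e\<close>, which send \<open>x\<close> to \<open>cinner x f *\<^sub>C e\<close>. Such an
  operator lies in \<open>A_of \<F>\<close> when each member has \<open>f\<close> orthogonal to its initial space or \<open>e\<close> in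
  its range. If it leaves the range of \<open>E\<close> invariant although \<open>e\<close> is not in that range, then
  \<open>f\<close> is orthogonal to the range of \<open>E\<close>. For \<open>E \<noteq> U\<close> the larger members supply vectors \<open>e\<close>,
  and enough vectors \<open>f\<close> to conclude that the range of \<open>E\<close> is contained in the initial space of
  \<open>E\<close> (\<open>range_subset_initial_space\<close>). For \<open>U\<close> the same works with any \<open>e\<close> outside the range of
  \<open>U\<close>, hence whenever that range is not the whole space
  (\<open>range_greatest_subset_initial_space\<close>).

  A partial isometry whose range is contained in its initial space is isometric on an invariant
  subspace and zero on the orthogonal complement, so all its powers are partial isometries
  (\<open>power_partial_isometry_if_range_subset\<close>). The dichotomy of the theorem is then whether \<open>U\<close>
  is a power partial isometry as well.

  To interpret \<open>A_of \<F>\<close> one needs adjoints, and these rest on the projection theorem and the Riesz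
  representation theorem for the class of complex Hilbert spaces at hand.\<close>

section \<open>Complex inner products\<close>

lemma cinner_add_right: "cinner x (y + z) = cinner x y + cinner x (z::'a::complex_inner)"
  by (metis cinner_add_left cinner_commute complex_cnj_add)

lemma cinner_scaleC_right: "cinner x (c *\<^sub>C y) = cnj c * cinner x (y::'a::complex_inner)"
  by (metis cinner_commute cinner_scaleC_left complex_cnj_mult)

lemma scaleC_0_left [simp]: "0 *\<^sub>C x = (0::'a::complex_inner)"
  by (metis add_cancel_right_right scaleC_add_left)

lemma scaleC_0_right [simp]: "c *\<^sub>C 0 = (0::'a::complex_inner)"
  by (metis add_cancel_right_right scaleC_add_right)

lemma scaleC_minus1: "(-1) *\<^sub>C x = - (x::'a::complex_inner)"
  by (metis scaleC_0_left add.right_inverse add_eq_0_iff scaleC_add_left scaleC_one)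

lemma cinner_zero_left [simp]: "cinner 0 (x::'a::complex_inner) = 0"
  by (metis add_cancel_right_right cinner_add_left)

lemma cinner_zero_right [simp]: "cinner (x::'a::complex_inner) 0 = 0"
  by (metis cinner_commute cinner_zero_left complex_cnj_zero)

lemma cinner_minus_left: "cinner (- x) (y::'a::complex_inner) = - cinner x y"
  by (metis cinner_scaleC_left mult_minus1 scaleC_minus1)

lemma cinner_minus_right: "cinner x (- y::'a::complex_inner) = - cinner x y"
  by (metis cinner_commute cinner_minus_left complex_cnj_minus)

lemma cinner_diff_left: "cinner (x - y) (z::'a::complex_inner) = cinner x z - cinner y z"
  by (metis cinner_add_left cinner_minus_left diff_conv_add_uminus)

lemma cinner_diff_right: "cinner x (y - z::'a::complex_inner) = cinner x y - cinner x z"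
  by (metis cinner_add_right cinner_minus_right diff_conv_add_uminus)

lemma cinner_eq_0_commute: "cinner x y = 0 \<longleftrightarrow> cinner y (x::'a::complex_inner) = 0"
  by (metis cinner_commute complex_cnj_zero)

lemma cinner_self_eq_0_iff [simp]: "cinner x x = 0 \<longleftrightarrow> x = (0::'a::complex_inner)"
  by (simp add: cinner_self)

lemma cinner_ext: "(\<And>x. cinner x y = cinner x z) \<Longrightarrow> y = (z::'a::complex_inner)"
  by (metis cinner_diff_right cinner_self_eq_0_iff eq_iff_diff_eq_0)

lemma norm_scaleC: "norm (c *\<^sub>C x) = cmod c * norm (x::'a::complex_inner)"
proof -
  have "complex_of_real ((norm (c *\<^sub>C x))\<^sup>2) = c * cnj c * complex_of_real ((norm x)\<^sup>2)"
    by (metis (no_types, lifting) cinner_scaleC_left cinner_scaleC_right cinner_self mult.assoc)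
  also have "\<dots> = complex_of_real ((cmod c * norm x)\<^sup>2)"
    by (simp add: complex_norm_square power_mult_distrib del: of_real_power)
  finally have "(norm (c *\<^sub>C x))\<^sup>2 = (cmod c * norm x)\<^sup>2"
    using of_real_eq_iff by blast
  then show ?thesis by simp
qed

lemma norm_add_squared:
  "(norm (x + y))\<^sup>2 = (norm x)\<^sup>2 + (norm y)\<^sup>2 + 2 * Re (cinner x (y::'a::complex_inner))"
proof -
  have "complex_of_real ((norm (x + y))\<^sup>2) =
      cinner x x + cinner y y + (cinner x y + cnj (cinner x y))"
    using cinner_self[of "x + y"] cinner_commute[of y x]
    by (simp add: cinner_add_left cinner_add_right algebra_simps)
  then have "Re (complex_of_real ((norm (x + y))\<^sup>2)) =
      Re (cinner x x + cinner y y + (cinner x y + cnj (cinner x y)))"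
    by (rule arg_cong)
  then show ?thesis
    by (simp add: cinner_self del: of_real_power)
qed

lemma norm_diff_squared:
  "(norm (x - y))\<^sup>2 = (norm x)\<^sup>2 + (norm y)\<^sup>2 - 2 * Re (cinner x (y::'a::complex_inner))"
  using norm_add_squared[of x "- y"] by (simp add: cinner_minus_right)

lemma parallelogram:
  "(norm (x + y))\<^sup>2 + (norm (x - y))\<^sup>2 = 2 * (norm x)\<^sup>2 + 2 * (norm (y::'a::complex_inner))\<^sup>2"
  by (simp add: norm_add_squared norm_diff_squared)

lemma orthogonal_norm_add:
  "cinner x y = 0 \<Longrightarrow> (norm (x + y))\<^sup>2 = (norm x)\<^sup>2 + (norm (y::'a::complex_inner))\<^sup>2"
  by (simp add: norm_add_squared)

text \<open>The squared norm of \<open>a - c *\<^sub>C y\<close> is least at \<open>c = cinner a y / (norm y)\<^sup>2\<close>, and this is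
  its value there. It yields both the Cauchy--Schwarz inequality and the orthogonality of the
  remainder in the projection theorem.\<close>

lemma norm_minus_component:
  assumes "y \<noteq> (0::'a::complex_inner)"
  shows "(norm (a - (cinner a y / of_real ((norm y)\<^sup>2)) *\<^sub>C y))\<^sup>2 =
      (norm a)\<^sup>2 - (cmod (cinner a y))\<^sup>2 / (norm y)\<^sup>2"
proof -
  define c where "c = cinner a y / of_real ((norm y)\<^sup>2)"
  have "cnj c * cinner a y = of_real ((cmod (cinner a y))\<^sup>2 / (norm y)\<^sup>2)"
    by (simp add: c_def complex_norm_square del: of_real_power)
  then have "Re (cinner a (c *\<^sub>C y)) = (cmod (cinner a y))\<^sup>2 / (norm y)\<^sup>2"
    by (metis Re_complex_of_real cinner_scaleC_right)
  moreover have "(norm (c *\<^sub>C y))\<^sup>2 = (cmod (cinner a y))\<^sup>2 / (norm y)\<^sup>2"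
    using assms by (simp add: c_def norm_scaleC norm_divide power_mult_distrib power_divide)
      (simp add: power2_eq_square norm_mult)
  ultimately show ?thesis
    unfolding c_def[symmetric] norm_diff_squared by simp
qed

lemma Cauchy_Schwarz: "cmod (cinner x y) \<le> norm x * norm (y::'a::complex_inner)"
proof (cases "y = 0")
  case False
  have "0 \<le> (norm x)\<^sup>2 - (cmod (cinner x y))\<^sup>2 / (norm y)\<^sup>2"
    using norm_minus_component[OF False, of x] by (metis zero_le_power2)
  then have "(cmod (cinner x y))\<^sup>2 \<le> (norm x * norm y)\<^sup>2"
    using False by (simp add: field_simps power_mult_distrib)
  then show ?thesis by (rule power2_le_imp_le) simp
qed simp

lemma bounded_linear_cinner_left: "bounded_linear (\<lambda>x. cinner x (y::'a::complex_inner))"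
proof (rule bounded_linear_intro[where K = "norm y"])
  show "cinner (r *\<^sub>R x) y = r *\<^sub>R cinner x y" for r x
    unfolding scaleR_scaleC[of r x] cinner_scaleC_left by (simp add: scaleR_conv_of_real)
qed (simp_all add: cinner_add_left Cauchy_Schwarz)

section \<open>Orthogonal projections and adjoints\<close>

definition complex_subspace :: "'a::complex_inner set \<Rightarrow> bool" where
  "complex_subspace M \<longleftrightarrow>
     0 \<in> M \<and> (\<forall>x\<in>M. \<forall>y\<in>M. x + y \<in> M) \<and> (\<forall>c. \<forall>x\<in>M. c *\<^sub>C x \<in> M)"

lemma complex_subspace_diff:
  "complex_subspace M \<Longrightarrow> x \<in> M \<Longrightarrow> y \<in> M \<Longrightarrow> x - y \<in> M"
  by (metis complex_subspace_def diff_conv_add_uminus scaleC_minus1)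

lemma complex_subspace_orth_compl: "complex_subspace (orth_compl S)"
  by (simp add: complex_subspace_def orth_compl_def cinner_add_left cinner_scaleC_left)

text \<open>A closest point of the subspace exists because, by the parallelogram law, a sequence of
  points whose distances to \<open>x\<close> tend to the infimum is Cauchy; the remainder at a closest point is
  orthogonal to the subspace because otherwise its component along some vector of the subspace
  could be removed to come closer.\<close>

theorem orthogonal_decomposition:
  fixes x :: "'a::chilbert_space"
  assumes cl: "closed M" and sub: "complex_subspace M"
  obtains m where "m \<in> M" "x - m \<in> orth_compl M"
proof -
  define d where "d = (INF m\<in>M. norm (x - m))"
  have ne: "M \<noteq> {}" using sub by (auto simp: complex_subspace_def)
  have bdd: "bdd_below ((\<lambda>m. norm (x - m)) ` M)" by (rule bdd_belowI[of _ 0]) auto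
  have d_le: "d \<le> norm (x - m)" if "m \<in> M" for m
    unfolding d_def by (rule cINF_lower[OF bdd that])
  have d0: "0 \<le> d" unfolding d_def using ne by (intro cINF_greatest) auto
  have "\<exists>m\<in>M. norm (x - m) < d + 1 / real (Suc n)" for n
    using cINF_less_iff[OF ne bdd, of "d + 1 / real (Suc n)"] by (simp flip: d_def)
  then obtain a where aM: "\<And>n. a n \<in> M" and a: "\<And>n. norm (x - a n) < d + 1 / real (Suc n)"
    by metis
  have lim: "(\<lambda>n. norm (x - a n)) \<longlonglongrightarrow> d"
  proof (rule tendsto_sandwich[of "\<lambda>n. d" _ _ "\<lambda>n. d + 1 / real (Suc n)"])
    show "(\<lambda>n. d + 1 / real (Suc n)) \<longlonglongrightarrow> d"
      using tendsto_add[OF tendsto_const lim_inverse_n'[THEN LIMSEQ_Suc], of d] by simp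
    show "\<forall>\<^sub>F n in sequentially. d \<le> norm (x - a n)"
      by (intro always_eventually allI d_le aM)
    show "\<forall>\<^sub>F n in sequentially. norm (x - a n) \<le> d + 1 / real (Suc n)"
      by (intro always_eventually allI less_imp_le a)
  qed (rule tendsto_const)
  \<comment> \<open>The midpoint of two points of \<open>M\<close> lies in \<open>M\<close>, so it is no closer than \<open>d\<close> to \<open>x\<close>.\<close>
  have diff_le: "(norm (p - q))\<^sup>2 \<le> 2 * (norm (x - p))\<^sup>2 + 2 * (norm (x - q))\<^sup>2 - 4 * d\<^sup>2"
    if "p \<in> M" "q \<in> M" for p q
  proof -
    have "(1/2) *\<^sub>C (p + q) \<in> M" using that sub by (auto simp: complex_subspace_def)
    then have "d \<le> norm (x - (1/2) *\<^sub>R (p + q))"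
      using d_le by (simp add: scaleR_scaleC)
    moreover have "(x - p) + (x - q) = 2 *\<^sub>R (x - (1/2) *\<^sub>R (p + q))"
      by (simp add: algebra_simps scaleR_2)
    ultimately have "(2 * d)\<^sup>2 \<le> (norm ((x - p) + (x - q)))\<^sup>2"
      using d0 by (intro power_mono) auto
    then show ?thesis
      using parallelogram[of "x - p" "x - q"] by (simp add: norm_minus_commute)
  qed
  have "Cauchy a"
  proof (rule metric_CauchyI)
    fix e :: real assume e: "e > 0"
    have "(\<lambda>n. (norm (x - a n))\<^sup>2) \<longlonglongrightarrow> d\<^sup>2" by (intro tendsto_intros lim)
    moreover have "d\<^sup>2 < d\<^sup>2 + e\<^sup>2 / 4" using e by simp
    ultimately have "\<forall>\<^sub>F n in sequentially. (norm (x - a n))\<^sup>2 < d\<^sup>2 + e\<^sup>2 / 4"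
      by (rule order_tendstoD(2))
    then obtain N where N: "\<And>n. n \<ge> N \<Longrightarrow> (norm (x - a n))\<^sup>2 < d\<^sup>2 + e\<^sup>2 / 4"
      by (auto simp: eventually_sequentially)
    have "dist (a m) (a n) < e" if "m \<ge> N" "n \<ge> N" for m n
    proof -
      have "(norm (a m - a n))\<^sup>2 < e\<^sup>2"
        using diff_le[OF aM aM, of m n] N[OF that(1)] N[OF that(2)] by linarith
      then show ?thesis using e by (simp add: dist_norm power2_less_imp_less)
    qed
    then show "\<exists>N. \<forall>m\<ge>N. \<forall>n\<ge>N. dist (a m) (a n) < e" by blast
  qed
  then obtain m where m: "a \<longlonglongrightarrow> m"
    using Cauchy_convergent_iff convergent_def by blast
  have mM: "m \<in> M" using closed_sequentially[OF cl] aM m by blast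
  have "(\<lambda>n. norm (x - a n)) \<longlonglongrightarrow> norm (x - m)" by (intro tendsto_intros m)
  then have nd: "norm (x - m) = d" using lim LIMSEQ_unique by blast
  have "cinner (x - m) y = 0" if y: "y \<in> M" for y
  proof (cases "y = 0")
    case False
    define c where "c = cinner (x - m) y / of_real ((norm y)\<^sup>2)"
    have "m + c *\<^sub>C y \<in> M" using mM y sub by (auto simp: complex_subspace_def)
    then have "d \<le> norm ((x - m) - c *\<^sub>C y)" using d_le by (metis diff_diff_eq)
    then have "d\<^sup>2 \<le> (norm ((x - m) - c *\<^sub>C y))\<^sup>2" using d0 by (rule power_mono)
    also have "\<dots> = d\<^sup>2 - (cmod (cinner (x - m) y))\<^sup>2 / (norm y)\<^sup>2"
      unfolding c_def norm_minus_component[OF False] nd ..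
    finally have "(cmod (cinner (x - m) y))\<^sup>2 / (norm y)\<^sup>2 \<le> 0" by simp
    then show ?thesis using False by (simp add: divide_le_0_iff)
  qed simp
  then show ?thesis using that[OF mM] by (auto simp: orth_compl_def)
qed

text \<open>A nonzero functional is determined, up to a scalar, by its kernel; so it is the inner product
  with a suitable multiple of any nonzero vector orthogonal to its kernel.\<close>

theorem Riesz_representation:
  fixes \<phi> :: "'a::chilbert_space \<Rightarrow> complex"
  assumes bl: "bounded_linear \<phi>" and hom: "\<And>c x. \<phi> (c *\<^sub>C x) = c * \<phi> x"
  obtains z where "\<And>x. \<phi> x = cinner x z"
proof (cases "\<forall>x. \<phi> x = 0")
  case True
  then show ?thesis using that[of 0] by simp
next
  case False
  interpret bounded_linear \<phi> by (rule bl)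
  obtain u where u: "\<phi> u \<noteq> 0" using False by blast
  have "closed {x. \<phi> x = 0}"
    by (intro closed_Collect_eq continuous_on_const linear_continuous_on bl)
  moreover have "complex_subspace {x. \<phi> x = 0}"
    by (simp add: complex_subspace_def add hom)
  ultimately obtain k where "k \<in> {x. \<phi> x = 0}" and k: "u - k \<in> orth_compl {x. \<phi> x = 0}"
    by (rule orthogonal_decomposition)
  define w where "w = u - k"
  have w: "\<phi> w \<noteq> 0" using u \<open>k \<in> _\<close> by (simp add: w_def diff)
  then have w0: "w \<noteq> 0" using zero by auto
  have "\<phi> x = cinner x ((cnj (\<phi> w) / of_real ((norm w)\<^sup>2)) *\<^sub>C w)" for x
  proof -
    have "\<phi> (\<phi> w *\<^sub>C x - \<phi> x *\<^sub>C w) = 0" by (simp add: diff hom)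
    then have "cinner w (\<phi> w *\<^sub>C x - \<phi> x *\<^sub>C w) = 0"
      using k by (simp add: orth_compl_def w_def)
    then have "cinner (\<phi> w *\<^sub>C x - \<phi> x *\<^sub>C w) w = 0"
      by (simp add: cinner_eq_0_commute)
    then have "\<phi> w * cinner x w = \<phi> x * of_real ((norm w)\<^sup>2)"
      by (simp add: cinner_diff_left cinner_scaleC_left cinner_self)
    then show ?thesis using w0 by (simp add: cinner_scaleC_right field_simps)
  qed
  then show ?thesis using that by blast
qed

lemma bounded_ops_linear: "T \<in> bounded_ops \<Longrightarrow> bounded_linear T"
  and bounded_ops_scaleC: "T \<in> bounded_ops \<Longrightarrow> T (c *\<^sub>C x) = c *\<^sub>C T x"
  by (auto simp: bounded_ops_def)

lemma bounded_ops_add: "T \<in> bounded_ops \<Longrightarrow> T (x + y) = T x + T y"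
  and bounded_ops_diff: "T \<in> bounded_ops \<Longrightarrow> T (x - y) = T x - T y"
  and bounded_ops_zero: "T \<in> bounded_ops \<Longrightarrow> T 0 = 0"
  by (auto dest!: bounded_ops_linear simp: linear_simps)

lemma adjoint_exists:
  assumes T: "T \<in> bounded_ops"
  shows "\<exists>W\<in>bounded_ops. \<forall>x y. cinner (T x) y = cinner x (W y)"
proof -
  have "\<exists>z. \<forall>x. cinner (T x) y = cinner x z" for y
  proof -
    have "bounded_linear (\<lambda>x. cinner (T x) y)"
      by (rule bounded_linear_compose[OF bounded_linear_cinner_left bounded_ops_linear[OF T]])
    then show ?thesis
      by (rule Riesz_representation) (auto simp: bounded_ops_scaleC[OF T] cinner_scaleC_left)
  qed
  then obtain W where W: "\<And>x y. cinner (T x) y = cinner x (W y)" by metis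
  have add: "W (x + y) = W x + W y" for x y
    by (rule cinner_ext) (simp add: cinner_add_right flip: W)
  have scale: "W (c *\<^sub>C x) = c *\<^sub>C W x" for c x
    by (rule cinner_ext) (simp add: cinner_scaleC_right flip: W)
  obtain K where K: "\<And>x. norm (T x) \<le> norm x * K"
    using bounded_linear.bounded[OF bounded_ops_linear[OF T]] by blast
  have "norm (W y) \<le> norm y * K" for y
  proof -
    have "(norm (W y))\<^sup>2 = cmod (cinner (T (W y)) y)"
      by (simp add: W cinner_self norm_power)
    also have "\<dots> \<le> norm (T (W y)) * norm y" by (rule Cauchy_Schwarz)
    also have "\<dots> \<le> (norm (W y) * K) * norm y" by (intro mult_right_mono K) simp
    finally have "norm (W y) * norm (W y) \<le> norm (W y) * (norm y * K)"
      by (simp add: power2_eq_square algebra_simps)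
    moreover have "0 \<le> norm y * K" using K[of y] norm_ge_zero order_trans by blast
    ultimately show ?thesis by (cases "W y = 0") auto
  qed
  then have "bounded_linear W"
    using add scale by (intro bounded_linear_intro[where K = K]) (auto simp: scaleR_scaleC)
  then have "W \<in> bounded_ops" using scale by (simp add: bounded_ops_def)
  then show ?thesis using W by blast
qed

lemma adjoint_op_spec:
  assumes T: "T \<in> bounded_ops"
  shows "adjoint_op T \<in> bounded_ops \<and> (\<forall>x y. cinner (T x) y = cinner x (adjoint_op T y))"
proof -
  obtain W where WB: "W \<in> bounded_ops" and W: "\<And>x y. cinner (T x) y = cinner x (W y)"
    using adjoint_exists[OF T] by blast
  have "adjoint_op T = W"
    unfolding adjoint_op_def
  proof (rule the_equality)
    show "W \<in> bounded_ops \<and> (\<forall>x y. cinner (T x) y = cinner x (W y))"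
      using WB W by simp
    fix V assume V: "V \<in> bounded_ops \<and> (\<forall>x y. cinner (T x) y = cinner x (V y))"
    have "V y = W y" for y
    proof (rule cinner_ext)
      show "cinner x (V y) = cinner x (W y)" for x
        using V W[of x y] by simp
    qed
    then show "V = W" by (rule ext)
  qed
  then show ?thesis using WB W by simp
qed

lemmas cinner_adjoint_op = adjoint_op_spec[THEN conjunct2, rule_format]

section \<open>Partial isometries\<close>

lemma partial_isometry_bounded: "partial_isometry V \<Longrightarrow> V \<in> bounded_ops"
  by (simp add: partial_isometry_def)

lemma partial_isometry_norm: "partial_isometry V \<Longrightarrow> x \<in> initial_space V \<Longrightarrow> norm (V x) = norm x"
  by (simp add: partial_isometry_def)

lemma complex_subspace_initial_space: "complex_subspace (initial_space V)"
  unfolding initial_space_def by (rule complex_subspace_orth_compl)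

lemma initial_space_orthogonal_kernel: "x \<in> initial_space V \<Longrightarrow> V k = 0 \<Longrightarrow> cinner x k = 0"
  by (simp add: initial_space_def orth_compl_def)

lemma kernel_plus_initial_space:
  assumes V: "V \<in> bounded_ops"
  obtains k i where "x = k + i" "V k = 0" "i \<in> initial_space V"
proof -
  have "closed {x. V x = 0}"
    by (intro closed_Collect_eq continuous_on_const linear_continuous_on bounded_ops_linear V)
  moreover have "complex_subspace {x. V x = 0}"
    by (simp add: complex_subspace_def bounded_ops_add[OF V] bounded_ops_zero[OF V]
        bounded_ops_scaleC[OF V])
  ultimately obtain k where "k \<in> {x. V x = 0}" "x - k \<in> initial_space V"
    unfolding initial_space_def by (rule orthogonal_decomposition)
  then show ?thesis using that[of k "x - k"] by simp
qed

lemma range_eq_image_initial_space: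
  assumes "V \<in> bounded_ops"
  shows "range V = V ` initial_space V"
proof -
  have "V x \<in> V ` initial_space V" for x
    by (metis kernel_plus_initial_space[OF assms, of x] add_0 assms bounded_ops_add imageI)
  then show ?thesis by auto
qed

lemma orthogonal_initial_space_kernel:
  assumes V: "V \<in> bounded_ops" and x: "\<And>i. i \<in> initial_space V \<Longrightarrow> cinner x i = 0"
  shows "V x = 0"
proof -
  obtain k i where ki: "x = k + i" "V k = 0" "i \<in> initial_space V"
    using kernel_plus_initial_space[OF V] by blast
  have "cinner k i = 0"
    using initial_space_orthogonal_kernel[OF ki(3,2)] by (simp add: cinner_eq_0_commute)
  then have "cinner i i = 0" using x[OF ki(3)] by (simp add: ki(1) cinner_add_left)
  then show ?thesis using ki by simp
qed

text \<open>Writing \<open>x\<close> as a vector of the kernel plus a vector of the initial space, the norm of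
  \<open>V x\<close> is that of the second summand, so by Pythagoras equality of norms forces the first one to
  vanish.\<close>

lemma in_initial_space_iff_norm:
  assumes V: "partial_isometry V"
  shows "x \<in> initial_space V \<longleftrightarrow> norm (V x) = norm x"
proof
  assume n: "norm (V x) = norm x"
  note B = partial_isometry_bounded[OF V]
  obtain k i where ki: "x = k + i" "V k = 0" "i \<in> initial_space V"
    using kernel_plus_initial_space[OF B] by blast
  have "cinner k i = 0"
    using initial_space_orthogonal_kernel[OF ki(3,2)] by (simp add: cinner_eq_0_commute)
  then have "(norm x)\<^sup>2 = (norm k)\<^sup>2 + (norm i)\<^sup>2" by (simp add: ki(1) orthogonal_norm_add)
  moreover have "norm (V x) = norm i"
    using ki partial_isometry_norm[OF V ki(3)] by (simp add: bounded_ops_add[OF B])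
  ultimately have "k = 0" using n by simp
  then show "x \<in> initial_space V" using ki by simp
qed (rule partial_isometry_norm[OF V])

lemma partial_isometry_inj:
  assumes V: "partial_isometry V" and "x \<in> initial_space V" "y \<in> initial_space V" "V x = V y"
  shows "x = y"
proof -
  have "x - y \<in> initial_space V"
    using assms complex_subspace_diff complex_subspace_initial_space by blast
  then have "norm (x - y) = norm (V (x - y))" by (simp add: partial_isometry_norm[OF V])
  also have "\<dots> = 0" using assms by (simp add: bounded_ops_diff partial_isometry_bounded)
  finally show ?thesis by simp
qed

text \<open>Polarization: an isometry of the initial space preserves the real parts of the inner products
  there, and, since multiplication by \<open>\<i>\<close> preserves the space, the imaginary parts as well.\<close>

lemma partial_isometry_cinner:
  assumes V: "partial_isometry V" and x: "x \<in> initial_space V" and y: "y \<in> initial_space V"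
  shows "cinner (V x) (V y) = cinner x y"
proof -
  note B = partial_isometry_bounded[OF V]
  have re: "Re (cinner (V x) (V y)) = Re (cinner x y)" if y: "y \<in> initial_space V" for y
  proof -
    have "x + y \<in> initial_space V"
      using x y complex_subspace_initial_space by (auto simp: complex_subspace_def)
    then have "norm (V x + V y) = norm (x + y)"
      by (metis B V bounded_ops_add partial_isometry_norm)
    then show ?thesis
      using norm_add_squared[of "V x" "V y"] norm_add_squared[of x y]
      by (simp add: partial_isometry_norm[OF V x] partial_isometry_norm[OF V y])
  qed
  have "\<i> *\<^sub>C y \<in> initial_space V"
    using y complex_subspace_initial_space[of V] by (simp add: complex_subspace_def)
  from re[OF this] have "Im (cinner (V x) (V y)) = Im (cinner x y)"
    by (simp add: bounded_ops_scaleC[OF B] cinner_scaleC_right)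
  with re[OF y] show ?thesis by (rule complex_eqI)
qed

lemma adjoint_op_in_initial_space:
  assumes "V \<in> bounded_ops"
  shows "adjoint_op V y \<in> initial_space V"
proof -
  have "cinner k (adjoint_op V y) = 0" if "V k = 0" for k
    by (metis assms cinner_adjoint_op cinner_zero_left that)
  then show ?thesis
    by (simp add: initial_space_def orth_compl_def cinner_eq_0_commute)
qed

lemma adjoint_op_left_inverse:
  assumes V: "partial_isometry V" and x: "x \<in> initial_space V"
  shows "adjoint_op V (V x) = x"
proof -
  note B = partial_isometry_bounded[OF V]
  define z where "z = adjoint_op V (V x) - x"
  have z: "z \<in> initial_space V" unfolding z_def
    by (intro complex_subspace_diff complex_subspace_initial_space x
        adjoint_op_in_initial_space B)
  have "cinner z (adjoint_op V (V x)) = cinner z x"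
    by (metis B V cinner_adjoint_op partial_isometry_cinner x z)
  then have "cinner z z = 0" by (simp add: z_def cinner_diff_right)
  then show ?thesis by (simp add: z_def)
qed

lemma final_proj_fixed_iff:
  assumes V: "partial_isometry V"
  shows "final_proj V y = y \<longleftrightarrow> y \<in> range V"
proof
  assume "y \<in> range V"
  then obtain x where "x \<in> initial_space V" "y = V x"
    using range_eq_image_initial_space[OF partial_isometry_bounded[OF V]] by auto
  then show "final_proj V y = y"
    by (simp add: final_proj_def adjoint_op_left_inverse[OF V])
qed (metis comp_apply final_proj_def rangeI)

text \<open>Every positive power of such a \<open>V\<close> is isometric on the invariant initial space, and its kernel
  is no larger than that of \<open>V\<close>, as \<open>V x\<close> already lies where the further powers are isometric.\<close>

lemma power_partial_isometry_if_range_subset: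
  assumes V: "partial_isometry V" and sub: "range V \<subseteq> initial_space V"
  shows "power_partial_isometry V"
proof -
  note B = partial_isometry_bounded[OF V]
  have pow: "V ^^ n \<in> bounded_ops" for n
  proof (induction n)
    case 0
    then show ?case by (simp add: bounded_ops_def id_def bounded_linear_ident)
  next
    case (Suc n)
    then show ?case
      using B by (auto simp: bounded_ops_def o_def intro: bounded_linear_compose)
  qed
  have iso: "(V ^^ n) x \<in> initial_space V \<and> norm ((V ^^ n) x) = norm x"
    if "x \<in> initial_space V" for n x
    using that by (induction n) (use sub partial_isometry_norm[OF V] in auto)
  have "partial_isometry (V ^^ Suc n)" for n
  proof -
    have "(V ^^ Suc n) x = 0 \<longleftrightarrow> V x = 0" for x
    proof -
      have "norm ((V ^^ n) (V x)) = norm (V x)" using iso sub by blast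
      then show ?thesis by (metis comp_apply funpow_Suc_right norm_eq_zero)
    qed
    then have "initial_space (V ^^ Suc n) = initial_space V" by (simp add: initial_space_def)
    then show ?thesis using pow iso by (simp only: partial_isometry_def) blast
  qed
  then show ?thesis
    by (metis B One_nat_def Suc_le_D power_partial_isometry_def)
qed

section \<open>Operators of rank one\<close>

definition rank_one :: "'a::chilbert_space \<Rightarrow> 'a \<Rightarrow> 'a \<Rightarrow> 'a" where
  "rank_one f e = (\<lambda>x. cinner x f *\<^sub>C e)"

lemma rank_one_bounded: "rank_one f e \<in> bounded_ops"
proof -
  have "bounded_linear (rank_one f e)"
  proof (rule bounded_linear_intro[where K = "norm f * norm e"])
    show "norm (rank_one f e x) \<le> norm x * (norm f * norm e)" for x
      using mult_right_mono[OF Cauchy_Schwarz[of x f], of "norm e"]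
      by (simp add: rank_one_def norm_scaleC mult.assoc)
  qed (simp_all add: rank_one_def cinner_add_left scaleC_add_left scaleR_scaleC
      cinner_scaleC_left scaleC_scaleC)
  then show ?thesis by (simp add: bounded_ops_def rank_one_def cinner_scaleC_left scaleC_scaleC)
qed

text \<open>A partial isometry \<open>V\<close> lies above this one exactly when \<open>V x = y\<close>, so such operators turn a
  statement about a single vector into one about the ordering.\<close>

lemma partial_isometry_line:
  fixes x y :: "'a::chilbert_space"
  assumes xy: "norm y = norm x" and x0: "x \<noteq> 0"
  defines "W \<equiv> rank_one x ((1 / of_real ((norm x)\<^sup>2)) *\<^sub>C y)"
  shows "partial_isometry W" "W x = y" "initial_space W = range (\<lambda>c. c *\<^sub>C x)"
proof -
  have y0: "y \<noteq> 0" using xy x0 by auto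
  have W: "W z = (cinner z x / of_real ((norm x)\<^sup>2)) *\<^sub>C y" for z
    by (simp add: W_def rank_one_def scaleC_scaleC)
  show Wx: "W x = y" using x0 by (simp add: W cinner_self scaleC_one)
  have "norm (W z) = 0 \<longleftrightarrow> cinner z x = 0" for z
    using x0 y0 by (simp add: W norm_scaleC)
  then have ker: "{z. W z = 0} = {z. cinner z x = 0}" by auto
  show ini: "initial_space W = range (\<lambda>c. c *\<^sub>C x)"
  proof (intro equalityI subsetI)
    fix z assume "z \<in> range (\<lambda>c. c *\<^sub>C x)"
    then show "z \<in> initial_space W"
      by (auto simp: initial_space_def ker orth_compl_def cinner_scaleC_left)
        (metis cinner_eq_0_commute)
  next
    fix z assume z: "z \<in> initial_space W"
    define c where "c = cinner z x / of_real ((norm x)\<^sup>2)"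
    have "cinner (z - c *\<^sub>C x) x = 0"
      using x0 by (simp add: c_def cinner_diff_left cinner_scaleC_left cinner_self)
    then have o: "cinner z (z - c *\<^sub>C x) = 0" "cinner x (z - c *\<^sub>C x) = 0"
      using z by (auto simp: initial_space_def ker orth_compl_def) (metis cinner_eq_0_commute)
    then have "cinner (z - c *\<^sub>C x) (z - c *\<^sub>C x) = 0"
      by (simp add: cinner_diff_left[of z] cinner_scaleC_left)
    then have "z = c *\<^sub>C x" by simp
    then show "z \<in> range (\<lambda>c. c *\<^sub>C x)" by blast
  qed
  have WB: "W \<in> bounded_ops" unfolding W_def by (rule rank_one_bounded)
  then show "partial_isometry W"
    using ini by (auto simp: partial_isometry_def bounded_ops_scaleC Wx norm_scaleC xy)
qed

section \<open>The Halmos--McLaughlin ordering\<close>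

lemma hm_le_apply: "E \<preceq> F \<Longrightarrow> x \<in> initial_space E \<Longrightarrow> F x = E x"
  by (simp add: hm_le_def)

lemma hm_le_initial_space:
  assumes "partial_isometry E" "partial_isometry F" "E \<preceq> F"
  shows "initial_space E \<subseteq> initial_space F"
  using assms by (auto simp: in_initial_space_iff_norm hm_le_def)

lemma hm_le_range:
  assumes "partial_isometry E" "E \<preceq> F"
  shows "range E \<subseteq> range F"
proof
  fix y assume "y \<in> range E"
  then obtain x where "x \<in> initial_space E" "y = E x"
    using range_eq_image_initial_space[OF partial_isometry_bounded[OF assms(1)]] by auto
  then show "y \<in> range F" using hm_le_apply[OF assms(2)] by (metis rangeI)
qed

lemma hm_le_antisym:
  assumes E: "partial_isometry E" and F: "partial_isometry F" and le: "E \<preceq> F" "F \<preceq> E"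
  shows "E = F"
proof
  fix x
  note BE = partial_isometry_bounded[OF E] and BF = partial_isometry_bounded[OF F]
  have eq: "initial_space E = initial_space F"
    using hm_le_initial_space[OF E F le(1)] hm_le_initial_space[OF F E le(2)] by blast
  obtain k i where ki: "x = k + i" "E k = 0" "i \<in> initial_space E"
    using kernel_plus_initial_space[OF BE] by blast
  have "F k = 0"
    using orthogonal_initial_space_kernel[OF BF, of k] initial_space_orthogonal_kernel ki(2)
    by (metis cinner_eq_0_commute eq)
  then show "E x = F x"
    using ki hm_le_apply[OF le(1) ki(3)] by (simp add: bounded_ops_add[OF BE] bounded_ops_add[OF BF])
qed

text \<open>A larger partial isometry agrees with the smaller one on the smaller initial space and is
  injective on its own; so it sends any additional initial vector outside the smaller range.\<close>

lemma hm_less_range: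
  assumes E: "partial_isometry E" and M: "partial_isometry M" and le: "E \<preceq> M" and ne: "E \<noteq> M"
  obtains e where "e \<in> range M" "e \<notin> range E"
proof -
  have "\<not> initial_space M \<subseteq> initial_space E"
  proof
    assume "initial_space M \<subseteq> initial_space E"
    then have "M \<preceq> E" using le by (auto simp: hm_le_def)
    then show False using hm_le_antisym[OF E M le] ne by blast
  qed
  then obtain z where z: "z \<in> initial_space M" "z \<notin> initial_space E" by blast
  have "M z \<notin> range E"
  proof
    assume "M z \<in> range E"
    then obtain z' where z': "z' \<in> initial_space E" "M z = E z'"
      using range_eq_image_initial_space[OF partial_isometry_bounded[OF E]] by auto
    have "z = z'"
      using partial_isometry_inj[OF M z(1)] hm_le_initial_space[OF E M le] z'
        hm_le_apply[OF le z'(1)] by auto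
    then show False using z z' by simp
  qed
  then show ?thesis using that by blast
qed

lemma pi_Sup_eq:
  assumes "is_pi_sup S U"
  shows "pi_Sup S = U"
  unfolding pi_Sup_def
proof (rule the_equality)
  show "V = U" if "is_pi_sup S V" for V
    using that assms unfolding is_pi_sup_def by (metis hm_le_antisym)
qed (rule assms)

text \<open>On a vector \<open>x\<close> of all the initial spaces the members agree with a common upper bound \<open>U\<close>.
  The partial isometry sending \<open>x\<close> to \<open>U x\<close> with the line through \<open>x\<close> as initial space is thus a
  lower bound of the family.\<close>

lemma initial_space_pi_inf:
  assumes L: "is_pi_inf S L" and S: "\<And>M. M \<in> S \<Longrightarrow> partial_isometry M \<and> M \<preceq> U"
    and ne: "S \<noteq> {}" and x: "\<And>M. M \<in> S \<Longrightarrow> x \<in> initial_space M"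
  shows "x \<in> initial_space L"
proof (cases "x = 0")
  case True
  then show ?thesis using complex_subspace_initial_space by (auto simp: complex_subspace_def)
next
  case False
  have Ux: "M x = U x" if "M \<in> S" for M using S x that hm_le_apply by metis
  then have n: "norm (U x) = norm x" using S x ne partial_isometry_norm by (metis ex_in_conv)
  obtain W where W: "partial_isometry W" "W x = U x" "initial_space W = range (\<lambda>c. c *\<^sub>C x)"
    using partial_isometry_line[OF n False] by blast
  have "W \<preceq> M" if "M \<in> S" for M
    using W Ux[OF that] S[OF that]
    by (auto simp: hm_le_def bounded_ops_scaleC partial_isometry_bounded)
  then have "W \<preceq> L" using L W(1) by (simp add: is_pi_inf_def)
  moreover have "x \<in> initial_space W" using W(3) scaleC_one by (metis rangeI)
  moreover have "partial_isometry L" using L by (simp add: is_pi_inf_def)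
  ultimately show ?thesis using hm_le_initial_space W(1) by blast
qed

section \<open>The set of operators attached to a family\<close>

text \<open>The projections disappear from the definition because the initial projection maps onto the
  initial space and the final projection fixes exactly the vectors of the range.\<close>

lemma A_of_iff:
  assumes pis: "\<And>E. E \<in> \<F> \<Longrightarrow> partial_isometry E"
  shows "T \<in> A_of \<F> \<longleftrightarrow> T \<in> bounded_ops \<and> (\<forall>E\<in>\<F>. T ` initial_space E \<subseteq> range E)"
proof -
  have "(\<lambda>x. x - final_proj E x) \<circ> T \<circ> initial_proj E = (\<lambda>x. 0) \<longleftrightarrow>
      T ` initial_space E \<subseteq> range E" if "E \<in> \<F>" for E
  proof -
    note E = pis[OF that]
    have proj: "range (initial_proj E) = initial_space E"
      using adjoint_op_in_initial_space[OF partial_isometry_bounded[OF E]]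
        adjoint_op_left_inverse[OF E]
      by (auto simp: initial_proj_def image_iff) metis
    have "T ` initial_space E \<subseteq> range E \<longleftrightarrow> (\<forall>x. T (initial_proj E x) \<in> range E)"
      unfolding image_subset_iff proj[symmetric] by simp
    moreover have "y \<in> range E \<longleftrightarrow> y - final_proj E y = 0" for y
      using final_proj_fixed_iff[OF E, of y] by auto
    ultimately show ?thesis by (simp add: fun_eq_iff)
  qed
  then show ?thesis by (auto simp: A_of_def)
qed

lemma rank_one_in_A_of:
  assumes pis: "\<And>E. E \<in> \<F> \<Longrightarrow> partial_isometry E"
    and "\<And>G. G \<in> \<F> \<Longrightarrow> f \<in> orth_compl (initial_space G) \<or> e \<in> range G"
  shows "rank_one f e \<in> A_of \<F>"
proof -
  have "rank_one f e x \<in> range G" if G: "G \<in> \<F>" and x: "x \<in> initial_space G" for G x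
  proof (cases "e \<in> range G")
    case True
    then show ?thesis
      by (metis (no_types, lifting) G bounded_ops_scaleC imageE partial_isometry_bounded pis
          rangeI rank_one_def)
  next
    case False
    then have "cinner x f = 0"
      using assms(2)[OF G] x by (auto simp: orth_compl_def cinner_eq_0_commute)
    then show ?thesis
      by (metis G bounded_ops_zero partial_isometry_bounded pis rangeI rank_one_def scaleC_0_left)
  qed
  then show ?thesis by (auto simp: A_of_iff[OF pis] rank_one_bounded)
qed

text \<open>The largest element \<open>U\<close> of the family maps each initial space onto the corresponding range,
  because it extends every member; so \<open>U\<close> lies in \<open>A_of \<F>\<close>, and, when this set is closed under
  composition, each of its operators \<open>T\<close> maps the range of \<open>E\<close>, which consists of vectors \<open>U x\<close>
  with \<open>x\<close> initial for \<open>E\<close>, into itself via \<open>T \<circ> U\<close>.\<close>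

lemma A_of_preserves_range:
  assumes pis: "\<And>E. E \<in> \<F> \<Longrightarrow> partial_isometry E" and alg: "subalgebra_ops (A_of \<F>)"
    and U: "U \<in> \<F>" "\<And>E. E \<in> \<F> \<Longrightarrow> E \<preceq> U"
    and T: "T \<in> A_of \<F>" and E: "E \<in> \<F>"
  shows "T ` range E \<subseteq> range E"
proof -
  have "U x \<in> range G" if "G \<in> \<F>" "x \<in> initial_space G" for G x
    using hm_le_apply[OF U(2)[OF that(1)] that(2)] by simp
  then have "U \<in> A_of \<F>"
    using U(1) by (auto simp: A_of_iff[OF pis] partial_isometry_bounded pis)
  then have "T \<circ> U \<in> A_of \<F>" using alg T by (simp add: subalgebra_ops_def)
  then have TU: "T (U x) \<in> range E" if "x \<in> initial_space E" for x
    using that E by (auto simp: A_of_iff[OF pis])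
  have "range E = E ` initial_space E"
    by (rule range_eq_image_initial_space[OF partial_isometry_bounded[OF pis[OF E]]])
  also have "\<dots> = U ` initial_space E"
    using hm_le_apply[OF U(2)[OF E]] by (auto intro!: image_cong)
  finally show ?thesis using TU by auto
qed

lemma rank_one_preserving_range:
  assumes E: "E \<in> bounded_ops" and x: "x \<in> range E" and e: "e \<notin> range E"
    and T: "rank_one f e ` range E \<subseteq> range E"
  shows "cinner x f = 0"
proof (rule ccontr)
  assume c: "cinner x f \<noteq> 0"
  have "cinner x f *\<^sub>C e \<in> range E" using T x by (auto simp: rank_one_def)
  then obtain y where "cinner x f *\<^sub>C e = E y" by blast
  then have "(1 / cinner x f) *\<^sub>C cinner x f *\<^sub>C e = E ((1 / cinner x f) *\<^sub>C y)"
    by (simp add: bounded_ops_scaleC[OF E])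
  then have "e \<in> range E" using c by (simp add: scaleC_scaleC scaleC_one)
  then show False using e by simp
qed

text \<open>For a member \<open>E\<close> other than the largest one, let \<open>L\<close> be the infimum of the members strictly
  above \<open>E\<close>. The operators \<open>rank_one f e\<close> with \<open>f\<close> in the kernel of some such member \<open>M\<close> and \<open>e\<close>
  in its range but not in that of \<open>E\<close> show that the range of \<open>E\<close> lies in the initial space of
  every \<open>M\<close>, hence in that of \<open>L\<close>. If \<open>L\<close> differs from \<open>E\<close>, it is an immediate successor of \<open>E\<close>;
  then \<open>f\<close> may even be taken in the kernel of \<open>E\<close>, with \<open>e\<close> in the range of \<open>L\<close>.\<close>

lemma range_subset_initial_space:
  assumes complete: "complete_family \<F>" and total: "totally_ordered_family \<F>"
    and alg: "subalgebra_ops (A_of \<F>)"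
    and U: "U \<in> \<F>" "\<And>E. E \<in> \<F> \<Longrightarrow> E \<preceq> U"
    and E: "E \<in> \<F>" "E \<noteq> U"
  shows "range E \<subseteq> initial_space E"
proof
  fix x assume x: "x \<in> range E"
  have pis: "partial_isometry G" if "G \<in> \<F>" for G
    using complete that by (simp add: complete_family_def)
  note B = pis[THEN partial_isometry_bounded]
  define S where "S = {M \<in> \<F>. E \<preceq> M \<and> E \<noteq> M}"
  have ne: "S \<noteq> {}" using U E by (auto simp: S_def)
  have sep: "cinner x f = 0"
    if "e \<notin> range E" "\<And>G. G \<in> \<F> \<Longrightarrow> f \<in> orth_compl (initial_space G) \<or> e \<in> range G" for f e
  proof (rule rank_one_preserving_range[OF B[OF E(1)] x that(1)])
    have "rank_one f e \<in> A_of \<F>" using that(2) by (intro rank_one_in_A_of pis)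
    then show "rank_one f e ` range E \<subseteq> range E"
      using A_of_preserves_range[of \<F> U _ E] pis alg U E(1) by blast
  qed
  have ker_perp: "f \<in> orth_compl (initial_space G)"
    if "G \<in> \<F>" "M \<in> \<F>" "G \<preceq> M" "M f = 0" for G M f
  proof -
    have "cinner i f = 0" if "i \<in> initial_space G" for i
      using that hm_le_initial_space pis \<open>G \<in> \<F>\<close> \<open>M \<in> \<F>\<close> \<open>G \<preceq> M\<close> \<open>M f = 0\<close>
      by (blast intro: initial_space_orthogonal_kernel)
    then show ?thesis by (simp add: orth_compl_def cinner_eq_0_commute)
  qed
  have above: "x \<in> initial_space M" if M: "M \<in> S" for M
  proof -
    have M': "M \<in> \<F>" "E \<preceq> M" "E \<noteq> M" using M by (auto simp: S_def)
    obtain e where e: "e \<in> range M" "e \<notin> range E"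
      using hm_less_range[OF pis[OF E(1)] pis[OF M'(1)] M'(2,3)] .
    have "cinner x f = 0" if f: "M f = 0" for f
    proof (rule sep[OF e(2)])
      fix G assume G: "G \<in> \<F>"
      then consider "G \<preceq> M" | "M \<preceq> G"
        using total M'(1) by (auto simp: totally_ordered_family_def)
      then show "f \<in> orth_compl (initial_space G) \<or> e \<in> range G"
        using ker_perp[OF G M'(1) _ f] hm_le_range[OF pis[OF M'(1)]] e(1) by cases blast+
    qed
    then show ?thesis by (simp add: initial_space_def orth_compl_def)
  qed
  obtain L where L: "L \<in> \<F>" "is_pi_inf S L"
    using complete ne unfolding complete_family_def S_def
    by (metis (no_types, lifting) mem_Collect_eq subsetI)
  have "x \<in> initial_space L"
    by (rule initial_space_pi_inf[OF L(2) _ ne above, of U]) (auto simp: S_def pis U)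
  moreover have "x \<in> initial_space E" if LE: "E \<noteq> L"
  proof -
    have EL: "E \<preceq> L" using L(2) pis[OF E(1)] by (auto simp: is_pi_inf_def S_def)
    obtain e where e: "e \<in> range L" "e \<notin> range E"
      using hm_less_range[OF pis[OF E(1)] pis[OF L(1)] EL LE] .
    have "cinner x f = 0" if f: "E f = 0" for f
    proof (rule sep[OF e(2)])
      fix G assume G: "G \<in> \<F>"
      then consider "G \<preceq> E" | "G \<in> S"
        using total E(1) by (auto simp: totally_ordered_family_def S_def hm_le_def)
      then show "f \<in> orth_compl (initial_space G) \<or> e \<in> range G"
      proof cases
        case 1
        then show ?thesis using ker_perp[OF G E(1) _ f] by blast
      next
        case 2
        then have "L \<preceq> G" using L(2) by (simp add: is_pi_inf_def)
        then show ?thesis using hm_le_range[OF pis[OF L(1)]] e(1) by blast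
      qed
    qed
    then show ?thesis by (simp add: initial_space_def orth_compl_def)
  qed
  ultimately show "x \<in> initial_space E" by blast
qed

text \<open>Here \<open>rank_one f e\<close> lies in \<open>A_of \<F>\<close> for every \<open>f\<close> in the kernel of \<open>U\<close>: no member has \<open>e\<close>
  in its range, but all the initial spaces are contained in that of \<open>U\<close>, hence orthogonal to
  \<open>f\<close>.\<close>

lemma range_greatest_subset_initial_space:
  assumes pis: "\<And>E. E \<in> \<F> \<Longrightarrow> partial_isometry E" and alg: "subalgebra_ops (A_of \<F>)"
    and U: "U \<in> \<F>" "\<And>E. E \<in> \<F> \<Longrightarrow> E \<preceq> U" and e: "e \<notin> range U"
  shows "range U \<subseteq> initial_space U"
proof
  fix x assume x: "x \<in> range U"
  have "cinner x f = 0" if f: "U f = 0" for f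
  proof (rule rank_one_preserving_range[OF partial_isometry_bounded[OF pis[OF U(1)]] x e])
    have "cinner f i = 0" if "G \<in> \<F>" "i \<in> initial_space G" for G i
      using that hm_le_initial_space[OF pis pis[OF U(1)] U(2)] f
        initial_space_orthogonal_kernel cinner_eq_0_commute by blast
    then have "rank_one f e \<in> A_of \<F>" by (intro rank_one_in_A_of pis) (auto simp: orth_compl_def)
    then show "rank_one f e ` range U \<subseteq> range U"
      using A_of_preserves_range[of \<F> U _ U] pis alg U by blast
  qed
  then show "x \<in> initial_space U" by (simp add: initial_space_def orth_compl_def)
qed

theorem corollary2p4:
  fixes \<F> :: "('a::chilbert_space \<Rightarrow> 'a) set"
  assumes "complete_family \<F>"
    and "totally_ordered_family \<F>"
    and "subalgebra_ops (A_of \<F>)"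
  shows "(\<forall>E\<in>\<F>. power_partial_isometry E) \<or>
    ((\<forall>E\<in>\<F>. E \<noteq> pi_Sup \<F> \<longrightarrow> power_partial_isometry E) \<and>
     \<not> power_partial_isometry (pi_Sup \<F>) \<and> range (pi_Sup \<F>) = UNIV)"
proof -
  have pis: "partial_isometry E" if "E \<in> \<F>" for E
    using assms(1) that by (simp add: complete_family_def)
  have "\<F> \<noteq> {}" using assms(1) by (auto simp: complete_family_def)
  then obtain U where U: "U \<in> \<F>" "is_pi_sup \<F> U"
    using assms(1) unfolding complete_family_def by (metis subset_refl)
  have le: "E \<preceq> U" if "E \<in> \<F>" for E using U(2) that by (simp add: is_pi_sup_def)
  have others: "power_partial_isometry E" if "E \<in> \<F>" "E \<noteq> U" for E
    by (intro power_partial_isometry_if_range_subset pis that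
        range_subset_initial_space[OF assms U(1) le])
  have "power_partial_isometry U" if proper: "range U \<noteq> UNIV"
  proof -
    obtain e where "e \<notin> range U" using proper by blast
    then have "range U \<subseteq> initial_space U"
      using range_greatest_subset_initial_space[of \<F> U e] pis assms(3) U(1) le by blast
    then show ?thesis by (rule power_partial_isometry_if_range_subset[OF pis[OF U(1)]])
  qed
  then show ?thesis using others unfolding pi_Sup_eq[OF U(2)] by blast
qed

end
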